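(* Assume $\widehat\kappa$ is a function of the sample $Y_{1:m}\in\mathbb{R}^m$ that is affine-equivariant, i.e. $\widehat\kappa(\lambda Y_{1:m}+t)=\lambda\widehat\kappa(Y_{1:m})+t$ for every $\lambda\neq0$ and $t\in\mathbb{R}$. Denote by $\widehat\mu(X_{1:n},Y_{1:m})=\widehat\mu(\widehat\kappa(Y_{1:m});X_{1:n})$ the shrinkage estimator applied to the base estimate $\widehat\kappa(Y_{1:m})$ and the sample $X_{1:n}$. Then for every $\lambda\neq0$ and $t\in\mathbb{R}$, $$\widehat\mu(\lambda(X_{1:n},Y_{1:m})+t)=\lambda\,\widehat\mu(X_{1:n},Y_{1:m})+t.$$
   Context: $w:[0,\infty)\to[0,1]$ is right-continuous and non-increasing with $w(0)=1$ and $\lim_{t\to\infty}w(t)=0$, and $\eta\in(0,n)$ is fixed. For a sample $x_{1:n}\in\mathbb{R}^n$ and $\kappa\in\mathbb{R}$, $$\widehat\alpha(\kappa;x_{1:n})=\inf\Big\{\alpha>0:\sum_{i=1}^n w(\alpha|x_i-\kappa|)\le n-\eta\Big\},$$ $$\widehat\mu(\kappa;x_{1:n})=\kappa+\frac1n\sum_{i=1}^n(x_i-\kappa)\,w\big(\widehat\alpha(\kappa;x_{1:n})|x_i-\kappa|\big).$$ For a tuple, $\lambda X_{1:n}+t=(\lambda X_1+t,\dots,\lambda X_n+t)$, and $\lambda(X_{1:n},Y_{1:m})+t=(\lambda X_{1:n}+t,\lambda Y_{1:m}+t)$. *)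

theory Defs
  imports "HOL-Analysis.Analysis"
begin

text \<open>The weight lives on the half-line of nonnegative reals; its values at negative
  arguments are unconstrained and never used.\<close>

definition weight_function :: "(real \<Rightarrow> real) \<Rightarrow> bool" where
  "weight_function w \<longleftrightarrow>
     (\<forall>t\<ge>0. 0 \<le> w t \<and> w t \<le> 1) \<and>
     (\<forall>t\<ge>0. continuous (at_right t) w) \<and>
     antimono_on {0..} w \<and>
     w 0 = 1 \<and>
     (w \<longlongrightarrow> 0) at_top"

text \<open>The infimum is taken in the extended reals, because the set can be empty (for
  instance when every sample point equals \<open>\<kappa>\<close>, as the sum is then constantly \<open>n\<close>); the
  value is \<open>\<infinity>\<close> in that case.  On \<^typ>\<open>real\<close>, \<open>Inf {}\<close> would be an arbitrary number.\<close>

definition alpha_hat :: "(real \<Rightarrow> real) \<Rightarrow> real \<Rightarrow> real \<Rightarrow> real ^ 'n \<Rightarrow> ereal" where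
  "alpha_hat w \<eta> \<kappa> x =
     Inf {ereal \<alpha> | \<alpha>. 0 < \<alpha> \<and> (\<Sum>i\<in>UNIV. w (\<alpha> * \<bar>x $ i - \<kappa>\<bar>)) \<le> real CARD('n) - \<eta>}"

text \<open>Extension of the weight to \<open>\<infinity>\<close> by its limit \<open>w(\<infinity>) = 0\<close>.\<close>

definition weight_ext :: "(real \<Rightarrow> real) \<Rightarrow> ereal \<Rightarrow> real" where
  "weight_ext w s = (if s = \<infinity> then 0 else w (real_of_ereal s))"

text \<open>If \<open>alpha_hat\<close> is \<open>\<infinity>\<close>, every summand below vanishes (for \<open>x $ i = \<kappa>\<close> because of
  the factor \<open>x $ i - \<kappa>\<close>), so the estimator returns the base estimate \<open>\<kappa>\<close>.\<close>

definition mu_hat :: "(real \<Rightarrow> real) \<Rightarrow> real \<Rightarrow> real \<Rightarrow> real ^ 'n \<Rightarrow> real" where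
  "mu_hat w \<eta> \<kappa> x =
     \<kappa> + (1 / real CARD('n)) *
       (\<Sum>i\<in>UNIV. (x $ i - \<kappa>) * weight_ext w (alpha_hat w \<eta> \<kappa> x * ereal \<bar>x $ i - \<kappa>\<bar>))"

definition affine_tuple :: "real \<Rightarrow> real \<Rightarrow> real ^ 'n \<Rightarrow> real ^ 'n" where
  "affine_tuple l t x = (\<chi> i. l * x $ i + t)"

definition affine_pair :: "real \<Rightarrow> real \<Rightarrow> (real ^ 'n) \<times> (real ^ 'm) \<Rightarrow> (real ^ 'n) \<times> (real ^ 'm)" where
  "affine_pair l t = (\<lambda>(x, y). (affine_tuple l t x, affine_tuple l t y))"

definition affine_equivariant :: "(real ^ 'm \<Rightarrow> real) \<Rightarrow> bool" where
  "affine_equivariant k \<longleftrightarrow>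
     (\<forall>y l t. l \<noteq> 0 \<longrightarrow> k (affine_tuple l t y) = l * k y + t)"

definition shrinkage_estimator ::
    "(real \<Rightarrow> real) \<Rightarrow> real \<Rightarrow> (real ^ 'm \<Rightarrow> real) \<Rightarrow> (real ^ 'n) \<times> (real ^ 'm) \<Rightarrow> real" where
  "shrinkage_estimator w \<eta> k = (\<lambda>(x, y). mu_hat w \<eta> (k y) x)"

end

theory Submission
  imports Defs
begin

text \<open>Moving the sample and the base point together by z -> l z + t multiplies every deviation
  from the base point by l. The threshold is therefore divided by \<bar>l\<bar>
  (\<open>alpha_hat_affine\<close>), so the arguments of the weight, threshold times absolute
  deviation, do not change. The weights being invariant, the mean weighted deviation is multiplied
  by l (\<open>mu_hat_affine\<close>). Equivariance of \<kappa>hat says that the base point does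
  move in this way.\<close>

text \<open>The factor \<bar>l\<bar> stands on the left, instead of a division on the right, so that
  it can later be absorbed into a product in \<open>ereal\<close>. The admissible scales of the
  original sample are \<bar>l\<bar> times those of the transformed one, and a positive factor
  commutes with the infimum.\<close>

lemma alpha_hat_affine:
  fixes x :: "real ^ 'n"
  assumes "l \<noteq> 0"
  shows "ereal \<bar>l\<bar> * alpha_hat w \<eta> (l * \<kappa> + t) (affine_tuple l t x) = alpha_hat w \<eta> \<kappa> x"
proof -
  define P where
    "P \<alpha> \<longleftrightarrow> 0 < \<alpha> \<and> (\<Sum>i\<in>UNIV. w (\<alpha> * \<bar>x $ i - \<kappa>\<bar>)) \<le> real CARD('n) - \<eta>" for \<alpha>
  have dist: "\<bar>affine_tuple l t x $ i - (l * \<kappa> + t)\<bar> = \<bar>l\<bar> * \<bar>x $ i - \<kappa>\<bar>" for i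
    by (simp add: affine_tuple_def flip: right_diff_distrib abs_mult)
  have P_scaled: "(0 < \<alpha> \<and> (\<Sum>i\<in>UNIV. w (\<alpha> * \<bar>affine_tuple l t x $ i - (l * \<kappa> + t)\<bar>))
      \<le> real CARD('n) - \<eta>) \<longleftrightarrow> P (\<bar>l\<bar> * \<alpha>)" for \<alpha>
    using assms unfolding P_def dist by (simp add: zero_less_mult_iff ac_simps)
  have "(*) (ereal \<bar>l\<bar>) ` {ereal \<alpha> | \<alpha>. P (\<bar>l\<bar> * \<alpha>)} = {ereal \<alpha> | \<alpha>. P \<alpha>}"
  proof (intro set_eqI iffI)
    fix s assume "s \<in> {ereal \<alpha> | \<alpha>. P \<alpha>}"
    then obtain \<alpha> where "s = ereal \<alpha>" "P \<alpha>" by blast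
    \<comment> \<open>Scaling by \<bar>l\<bar> is onto because l is nonzero: the preimage of
      \<alpha> is \<alpha> / \<bar>l\<bar>.\<close>
    then have "s = ereal \<bar>l\<bar> * ereal (\<alpha> / \<bar>l\<bar>)" "P (\<bar>l\<bar> * (\<alpha> / \<bar>l\<bar>))"
      using assms by simp_all
    then show "s \<in> (*) (ereal \<bar>l\<bar>) ` {ereal \<alpha> | \<alpha>. P (\<bar>l\<bar> * \<alpha>)}" by blast
  qed auto
  then have "Inf {ereal \<alpha> | \<alpha>. P \<alpha>} = (INF s\<in>{ereal \<alpha> | \<alpha>. P (\<bar>l\<bar> * \<alpha>)}. ereal \<bar>l\<bar> * s)"
    by simp
  \<comment> \<open>This covers the empty set as well, since a positive real times \<infinity> is
    \<infinity>.\<close>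
  also have "\<dots> = ereal \<bar>l\<bar> * Inf {ereal \<alpha> | \<alpha>. P (\<bar>l\<bar> * \<alpha>)}"
    using ereal_Inf_cmult[of "\<bar>l\<bar>" "\<lambda>s. s \<in> {ereal \<alpha> | \<alpha>. P (\<bar>l\<bar> * \<alpha>)}"] assms
    by (simp only: setcompr_eq_image Collect_mem_eq)
  finally show ?thesis
    unfolding alpha_hat_def P_scaled by (simp only: P_def)
qed

text \<open>The base point is arbitrary here; the theorem takes \<kappa> to be
  \<open>\<kappa>hat Y\<close>.\<close>

lemma mu_hat_affine:
  fixes x :: "real ^ 'n"
  assumes "l \<noteq> 0"
  shows "mu_hat w \<eta> (l * \<kappa> + t) (affine_tuple l t x) = l * mu_hat w \<eta> \<kappa> x + t"
proof -
  have diff: "affine_tuple l t x $ i - (l * \<kappa> + t) = l * (x $ i - \<kappa>)" for i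
    by (simp add: affine_tuple_def right_diff_distrib)
  have "alpha_hat w \<eta> (l * \<kappa> + t) (affine_tuple l t x) * ereal \<bar>l * (x $ i - \<kappa>)\<bar> =
      alpha_hat w \<eta> \<kappa> x * ereal \<bar>x $ i - \<kappa>\<bar>" for i
    \<comment> \<open>Both sides become the same product of the new threshold, \<bar>l\<bar> and the
      old deviation. Multiplication in \<open>ereal\<close> is associative and commutative, so an
      infinite threshold needs no separate case.\<close>
    unfolding alpha_hat_affine[OF assms, of w \<eta> \<kappa> t x, symmetric] abs_mult
      times_ereal.simps(1)[symmetric]
    by (simp only: ac_simps)
  then show ?thesis
    unfolding mu_hat_def diff
    by (simp only: mult.assoc flip: sum_distrib_left) (simp add: distrib_left)
qed

theorem proposition4p1:
  fixes w :: "real \<Rightarrow> real" and \<eta> :: real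
    and \<kappa>hat :: "real ^ 'm \<Rightarrow> real"
    and X :: "real ^ 'n" and Y :: "real ^ 'm"
    and l t :: real
  assumes "weight_function w"
    and "0 < \<eta>" and "\<eta> < real CARD('n)"
    and "affine_equivariant \<kappa>hat"
    and "l \<noteq> 0"
  shows "shrinkage_estimator w \<eta> \<kappa>hat (affine_pair l t (X, Y)) =
           l * shrinkage_estimator w \<eta> \<kappa>hat (X, Y) + t"
  using assms(4,5)
  by (simp add: shrinkage_estimator_def affine_pair_def affine_equivariant_def mu_hat_affine)

end
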